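(* Let $n\ge 2$. For almost every $x\in\mathcal{L}_n$, the orbit $Ax=\{ax:a\in A\}$ contains a well-rounded lattice.
   Context: $G=\mathrm{SL}_n(\mathbb{R})$; $A\subset G$ is the subgroup of diagonal matrices with positive diagonal entries (and determinant $1$). $\mathcal{L}_n=G/\mathrm{SL}_n(\mathbb{Z})$ is the space of unimodular (covolume one) lattices in $\mathbb{R}^n$, where the coset $g\,\mathrm{SL}_n(\mathbb{Z})$ is identified with the lattice $g\mathbb{Z}^n$; $G$ (hence $A$) acts on it by left translations. "Almost every" is with respect to the $G$-invariant probability measure on $\mathcal{L}_n$ induced by Haar measure on $G$. A lattice $x\in\mathcal{L}_n$ is called well-rounded if the nonzero vectors of $x$ of shortest Euclidean length span $\mathbb{R}^n$. *)

theory Defs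
  imports "HOL-Probability.Probability"
begin

definition SL_real :: "(real^'n^'n) set" where
  "SL_real = {g. det g = 1}"

definition SL_int :: "(real^'n^'n) set" where
  "SL_int = {g \<in> SL_real. \<forall>i j. g $ i $ j \<in> \<int>}"

definition pos_diag :: "(real^'n^'n) set" where
  "pos_diag = {a \<in> SL_real. (\<forall>i j. i \<noteq> j \<longrightarrow> a $ i $ j = 0) \<and> (\<forall>i. a $ i $ i > 0)}"

definition coset :: "real^'n^'n \<Rightarrow> (real^'n^'n) set" where
  "coset g = (\<lambda>\<gamma>. g ** \<gamma>) ` SL_int"

definition lattice_space :: "(real^'n^'n) set set" where
  "lattice_space = coset ` SL_real"

definition translate :: "real^'n^'n \<Rightarrow> (real^'n^'n) set \<Rightarrow> (real^'n^'n) set" where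
  "translate g x = (\<lambda>h. g ** h) ` x"

definition diag_orbit :: "(real^'n^'n) set \<Rightarrow> (real^'n^'n) set set" where
  "diag_orbit x = {translate a x | a. a \<in> pos_diag}"

text \<open>The generators are the open sets of the quotient topology on the coset space,
  \<open>SL_real\<close> carrying the subspace topology of the space of matrices.\<close>

definition lattice_borel :: "(real^'n^'n) set measure" where
  "lattice_borel = sigma lattice_space
     {U. U \<subseteq> lattice_space \<and> openin (top_of_set SL_real) {g \<in> SL_real. coset g \<in> U}}"

text \<open>The invariant probability measure exists and is unique; it is the one induced by Haar
  measure. It is characterised here instead of being constructed.\<close>

definition invariant_prob :: "(real^'n^'n) set measure \<Rightarrow> bool" where
  "invariant_prob M \<longleftrightarrow> prob_space M \<and> sets M = sets lattice_borel \<and>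
     (\<forall>g\<in>SL_real. \<forall>B\<in>sets M. emeasure M (translate g ` B) = emeasure M B)"

definition int_vectors :: "(real^'n) set" where
  "int_vectors = {v. \<forall>i. v $ i \<in> \<int>}"

text \<open>The subset of Euclidean space identified with a coset; every representative gives the
  same one, see \<open>points_coset\<close> below.\<close>

definition points :: "(real^'n^'n) set \<Rightarrow> (real^'n) set" where
  "points x = (\<Union>g\<in>x. (\<lambda>v. g *v v) ` int_vectors)"

definition shortest_vectors :: "(real^'n) set \<Rightarrow> (real^'n) set" where
  "shortest_vectors L = {v \<in> L - {0}. \<forall>w \<in> L - {0}. norm v \<le> norm w}"

definition well_rounded :: "(real^'n^'n) set \<Rightarrow> bool" where
  "well_rounded x \<longleftrightarrow> span (shortest_vectors (points x)) = UNIV"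

lemma points_coset: "points (coset g) = (\<lambda>v. g *v v) ` int_vectors"
proof -
  have one: "mat 1 \<in> SL_int"
    unfolding SL_int_def SL_real_def by (simp add: det_I) (simp add: mat_def)
  have int: "h *v v \<in> int_vectors" if "h \<in> SL_int" "v \<in> int_vectors" for h and v :: "real^'n"
    using that
    by (auto simp: SL_int_def int_vectors_def matrix_vector_mult_def intro!: Ints_sum Ints_mult)
  show ?thesis
  proof
    show "points (coset g) \<subseteq> (\<lambda>v. g *v v) ` int_vectors"
      using int by (auto simp: points_def coset_def simp flip: matrix_vector_mul_assoc)
    have "g \<in> coset g"
      using one unfolding coset_def by (metis image_eqI matrix_mul_rid)
    then show "(\<lambda>v. g *v v) ` int_vectors \<subseteq> points (coset g)"
      by (auto simp: points_def)
  qed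
qed

lemma translate_coset: "translate a (coset g) = coset (a ** g)"
  by (simp add: translate_def coset_def image_image matrix_mul_assoc)

end

theory Submission imports Defs begin

text \<open>If \<open>g\<close> is close to the identity, then the diagonal matrices \<open>d\<close> for which the columns of
  \<open>d g\<close> have equal length are found by solving a linear system close to the identity system. For a
  solution \<open>d g\<close> is close to a multiple of the identity, so its columns are shortest vectors of
  the lattice that they generate. Hence the lattices whose diagonal orbit contains a well-rounded
  one include a non-empty open diagonal-invariant set \<open>V\<close>.

  It remains to see that such a \<open>V\<close> has full measure. Let \<open>u\<close> be a transvection and choose diagonal
  \<open>a\<^sub>k\<close> with \<open>v\<^sub>k = a\<^sub>k u\<inverse> a\<^sub>k\<inverse> \<longlonglongrightarrow> 1\<close>. Translation by \<open>a\<^sub>k u\<close> sends \<open>{x. u x \<in> V \<and> x \<notin> V}\<close> into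
  \<open>{x \<in> V. v\<^sub>k x \<notin> V}\<close>, whose measure tends to \<open>0\<close> because \<open>V\<close> is open. So \<open>u x \<in> V\<close> implies
  \<open>x \<in> V\<close> almost everywhere. As transvections and diagonal matrices generate the group, this holds
  for all group elements, in particular simultaneously for a countable dense set of them, and each
  orbit of that set meets \<open>V\<close>.\<close>

section \<open>Diagonal matrices and transvections\<close>

definition diagm :: "('n \<Rightarrow> real) \<Rightarrow> real^'n^'n" where
  "diagm d = (\<chi> i j. if i = j then d i else 0)"

definition transvection :: "'n \<Rightarrow> 'n \<Rightarrow> real \<Rightarrow> real^'n^'n" where
  "transvection m n c = (\<chi> i j. if i = m \<and> j = n then c else of_bool (i = j))"

lemma diagm_mult_nth: "(diagm d ** A) $ i $ j = d i * A $ i $ j"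
  by (simp add: diagm_def matrix_matrix_mult_def if_distrib [of "\<lambda>x. x * y" for y] cong: if_cong)

lemma mult_diagm_nth: "(A ** diagm d) $ i $ j = A $ i $ j * d j"
  by (simp add: diagm_def matrix_matrix_mult_def if_distrib [of "\<lambda>x. y * x" for y] cong: if_cong)

lemma diagm_vec_nth: "(diagm d *v w) $ i = d i * w $ i"
  by (simp add: diagm_def matrix_vector_mult_def if_distrib [of "\<lambda>x. x * y" for y] cong: if_cong)

lemma diagm_mult_diagm: "diagm d ** diagm e = diagm (\<lambda>i. d i * e i)"
  by (simp add: vec_eq_iff diagm_mult_nth) (simp add: diagm_def)

lemma diagm_one: "diagm (\<lambda>_. 1) = mat 1"
  by (simp add: diagm_def mat_def)

lemma prod_eq_1_nonzero: "prod d UNIV = 1 \<Longrightarrow> d i \<noteq> 0" for d :: "'n::finite \<Rightarrow> real"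
  by (metis UNIV_I finite prod_zero zero_neq_one)

lemma det_diagm: "det (diagm d) = prod d UNIV"
  by (subst det_diagonal) (simp_all add: diagm_def)

lemma norm_diagm_vec:
  assumes "\<And>i. \<bar>d i\<bar> = c * \<bar>e i\<bar>" "c \<ge> 0"
  shows "norm (diagm d *v w) = c * norm (diagm e *v w)"
proof -
  have "norm (diagm d *v w) = norm (c *\<^sub>R (diagm e *v w))"
    using assms(2) by (simp add: norm_vec_def diagm_vec_nth abs_mult assms(1) mult.assoc)
  then show ?thesis using assms by simp
qed

text \<open>Since \<open>e\<close> is the entrywise inverse of \<open>d\<close>, this is
  conjugation; it multiplies the off-diagonal entry by \<open>d m / d n\<close>, which can be made
  as small as desired.\<close>

lemma diagm_transvection:
  assumes "m \<noteq> n" and "\<And>i. d i * e i = 1"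
  shows "diagm d ** transvection m n c ** diagm e = transvection m n (d m * c * e n)"
  using assms by (auto simp: vec_eq_iff diagm_mult_nth mult_diagm_nth transvection_def)

lemma transvection_mult_nth:
  assumes "m \<noteq> n"
  shows "(transvection m n c ** A) $ i $ j = A $ i $ j + (if i = m then c * A $ n $ j else 0)"
proof -
  have "(transvection m n c ** A) $ i $ j =
    (\<Sum>k\<in>UNIV. (if k = i then A $ k $ j else 0) + (if k = n then (if i = m then c * A $ k $ j else 0) else 0))"
    using assms by (auto simp: matrix_matrix_mult_def transvection_def intro!: sum.cong)
  also have "\<dots> = A $ i $ j + (if i = m then c * A $ n $ j else 0)"
    by (simp add: sum.distrib)
  finally show ?thesis .
qed

lemma transvection_mult_transvection:
  assumes "m \<noteq> n"
  shows "transvection m n c ** transvection m n c' = transvection m n (c + c')"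
  using assms by (auto simp: vec_eq_iff transvection_mult_nth) (auto simp: transvection_def)

lemma transvection_zero: "m \<noteq> n \<Longrightarrow> transvection m n 0 = mat 1"
  by (auto simp: transvection_def mat_def vec_eq_iff)

lemma det_transvection: "m \<noteq> n \<Longrightarrow> det (transvection m n c) = 1"
proof -
  assume "m \<noteq> n"
  have "transvection m n c = (\<chi> k. if k = m then row m (mat 1) + c *s row n (mat 1) else row k (mat 1))"
    using \<open>m \<noteq> n\<close> by (auto simp: transvection_def vec_eq_iff row_def mat_def)
  then show ?thesis using det_row_operation[OF \<open>m \<noteq> n\<close>, where A="mat 1" and c=c] by simp
qed

text \<open>The three transvections multiply to a quarter turn in the plane of coordinates
  \<open>m\<close> and \<open>n\<close>; the diagonal factor corrects its sign to the swap of
  determinant -1.\<close>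

lemma swap_eq_transvections:
  fixes m n :: "'n::finite"
  assumes "m \<noteq> n"
  shows "(\<chi> i j. mat 1 $ i $ Transposition.transpose m n j) =
    transvection m n 1 ** (transvection n m (-1) ** (transvection m n 1 ** (diagm (\<lambda>i. if i = m then -1 else 1) :: real^'n^'n)))"
  using assms
  by (auto simp: vec_eq_iff transvection_mult_nth)
   (auto simp: diagm_def mat_def Transposition.transpose_def)

section \<open>Bases of shortest vectors\<close>

text \<open>Being itself lattice vectors, the columns attain the minimum \<open>r\<close>. The
  determinant is left free, so that rescaling to determinant 1 can be postponed.\<close>

definition balanced :: "real^'n^'n \<Rightarrow> bool" where
  "balanced h \<longleftrightarrow> (\<exists>r. (\<forall>i. norm (h *v axis i 1) = r) \<and> (\<forall>v\<in>int_vectors - {0}. r \<le> norm (h *v v)))"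

lemma balanced_diagm:
  assumes "balanced (diagm e ** h)" and "\<And>i. \<bar>d i\<bar> = c * \<bar>e i\<bar>" "c \<ge> 0"
  shows "balanced (diagm d ** h)"
proof -
  have "norm (diagm d ** h *v w) = c * norm (diagm e ** h *v w)" for w
    using norm_diagm_vec[OF assms(2,3)] by (simp flip: matrix_vector_mul_assoc)
  then show ?thesis
    using assms(1,3) unfolding balanced_def by (metis mult_left_mono)
qed

text \<open>The columns of \<open>h\<close> are shortest vectors, and they span because
  \<open>h\<close> is invertible.\<close>

lemma well_rounded_coset:
  assumes "balanced h" "det h \<noteq> 0"
  shows "well_rounded (coset h)"
proof -
  obtain r where r: "\<And>i. norm (h *v axis i 1) = r"
    "\<And>v. v \<in> int_vectors \<Longrightarrow> v \<noteq> 0 \<Longrightarrow> r \<le> norm (h *v v)"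
    using assms(1) unfolding balanced_def by blast
  have inv: "invertible h" using assms(2) invertible_det_nz by blast
  then have nz: "h *v v \<noteq> 0" if "v \<noteq> 0" for v
    using that by (metis inj_matrix_vector_mult injD matrix_vector_mult_0_right)
  have "h *v axis i 1 \<in> shortest_vectors (points (coset h))" for i
  proof -
    have "axis i 1 \<in> (int_vectors :: (real^'a) set)"
      by (auto simp: int_vectors_def axis_def)
    then show ?thesis using r nz
      unfolding shortest_vectors_def points_coset
      by (auto simp: image_iff axis_eq_0_iff) (metis matrix_vector_mult_0_right)
  qed
  then have "columns h \<subseteq> shortest_vectors (points (coset h))"
    by (auto simp: columns_image_basis)
  moreover have "span (columns h) = UNIV"
    by (metis inv invertible_def iso_tuple_UNIV_I matrix_left_right_inverse matrix_right_invertible_span_columns set_eqI span_vec_eq)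
  ultimately show ?thesis
    unfolding well_rounded_def by (metis span_mono top.extremum_uniqueI)
qed

text \<open>Two nonzero coordinates, or one of absolute value at least 2, already force squared
  length at least 2.\<close>

lemma int_vector_cases:
  fixes v :: "real^'n"
  assumes "v \<in> int_vectors" "v \<noteq> 0"
  obtains i where "v = axis i 1 \<or> v = - axis i 1" | "sqrt 2 \<le> norm v"
proof -
  obtain i where i: "v $ i \<noteq> 0" using assms(2) by (auto simp: vec_eq_iff)
  have sq: "(norm v)\<^sup>2 = (\<Sum>j\<in>UNIV. (v $ j)\<^sup>2)"
    by (simp add: norm_vec_def L2_set_def sum_nonneg)
  have ge1: "1 \<le> (v $ j)\<^sup>2" if "v $ j \<noteq> 0" for j
  proof -
    obtain k where k: "v $ j = of_int k" using assms(1) by (auto simp: int_vectors_def elim!: Ints_cases)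
    then have "1 \<le> k\<^sup>2" using that by (simp add: int_one_le_iff_zero_less)
    then show ?thesis using k by (metis of_int_1_le_iff of_int_power)
  qed
  show thesis
  proof (cases "\<exists>j. j \<noteq> i \<and> v $ j \<noteq> 0")
    case True
    then obtain j where j: "j \<noteq> i" "v $ j \<noteq> 0" by blast
    have "2 \<le> (\<Sum>j\<in>{i,j}. (v $ j)\<^sup>2)" using j ge1[OF i] ge1[of j] by simp
    also have "\<dots> \<le> (norm v)\<^sup>2" unfolding sq by (rule sum_mono2) auto
    finally show ?thesis using that(2) real_le_lsqrt norm_ge_zero by blast
  next
    case False
    then have v: "v = axis i (v $ i)" by (auto simp: vec_eq_iff axis_def)
    obtain k where k: "v $ i = of_int k" using assms(1) by (auto simp: int_vectors_def elim!: Ints_cases)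
    show ?thesis
    proof (cases "\<bar>k\<bar> = 1")
      case True
      then have "k = 1 \<or> k = -1" by auto
      then have "v = axis i 1 \<or> v = - axis i 1"
      using v k by (auto simp: vec_eq_iff axis_def)
      then show ?thesis using that by blast
    next
      case False
      then have "2 \<le> \<bar>k\<bar>" using i k by auto
      then have "2 \<le> \<bar>v $ i\<bar>" using k by linarith
      also have "\<dots> \<le> norm v" by (rule component_le_norm_cart)
      finally have "2 \<le> norm v" .
      moreover have "sqrt 2 \<le> 2" by (simp add: real_le_lsqrt)
      ultimately show ?thesis using that(2) by linarith
    qed
  qed
qed

text \<open>The gap between lengths 1 and \<open>sqrt 2\<close> in the integer lattice survives a
  distortion of lengths by at most one tenth.\<close>

lemma balanced_near_identity:
  fixes h :: "real^'n^'n"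
  assumes near: "\<And>i j. \<bar>(h - mat 1) $ i $ j\<bar> \<le> 1 / (10 * (CARD('n))\<^sup>2)"
    and eq: "\<And>i. norm (h *v axis i 1) = r"
  shows "balanced h"
proof -
  \<comment> \<open>The entrywise tolerance is chosen so that summing over all entries bounds the
    operator norm by 1/10.\<close>
  have "onorm ((*v) (h - mat 1)) \<le> real CARD('n) * real CARD('n) * (1 / (10 * (CARD('n))\<^sup>2))"
    using near by (rule onorm_le_matrix_component)
  also have "\<dots> = 1/10" by (simp add: power2_eq_square)
  finally have on: "onorm ((*v) (h - mat 1)) \<le> 1/10" .
  have near: "norm (h *v v - v) \<le> norm v / 10" for v
  proof -
    have "norm ((h - mat 1) *v v) \<le> onorm ((*v) (h - mat 1)) * norm v"
      by (intro onorm matrix_vector_mul_bounded_linear)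
    also have "\<dots> \<le> norm v / 10"  using mult_right_mono[OF on, of "norm v"] by simp
    finally show ?thesis by (simp add: matrix_vector_mult_diff_rdistrib)
  qed
  have "r \<le> norm (h *v v)" if v: "v \<in> int_vectors" "v \<noteq> 0" for v
    using v
  proof (cases rule: int_vector_cases)
    case (1 i)
    then show ?thesis using eq[of i] by (auto simp: vec.neg)
  next
    case 2
    \<comment> \<open>Any column serves to bound \<open>r\<close> from above.\<close>
    obtain i :: 'n where True by blast
    have "r \<le> 11/10"
      using near[of "axis i 1"] norm_triangle_ineq2[of "h *v axis i 1" "axis i 1"] eq[of i] by simp
    also have "\<dots> \<le> 9/10 * sqrt 2" using real_le_rsqrt[of "11/9" 2] by (simp add: power2_eq_square)
    also have "\<dots> \<le> 9/10 * norm v" using 2 by simp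
    also have "\<dots> \<le> norm (h *v v)"
      using near[of v] norm_triangle_ineq3[of v "h *v v"] by (simp add: norm_minus_commute)
    finally show ?thesis .
  qed
  then show ?thesis using eq unfolding balanced_def by blast
qed

lemma exists_balancing_neighbourhood:
  obtains N :: "(real^'n^'n) set" where "open N" "mat 1 \<in> N"
    "\<And>g. g \<in> N \<Longrightarrow> \<exists>d. (\<forall>i. d i > 0) \<and> balanced (diagm d ** g)"
proof -
  \<comment> \<open>The \<open>i\<close>-th column of \<open>diagm d ** g\<close> has squared length \<open>\<Sum>j. (d j)\<^sup>2 * (g $ j $ i)\<^sup>2\<close>, so unit
    columns mean a linear system for the squares \<open>s j = (d j)\<^sup>2\<close>, which Cramer's rule solves
    continuously in \<open>g\<close>.\<close>
  define Q :: "real^'n^'n \<Rightarrow> real^'n^'n" where "Q g = (\<chi> i j. (g $ j $ i)\<^sup>2)" for g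
  define s where "s g k = det (\<chi> i j. if j = k then 1 else Q g $ i $ j) / det (Q g)" for g k
  have Q1: "Q (mat 1) = mat 1" by (auto simp: Q_def mat_def vec_eq_iff)
  have contQ: "((\<lambda>g. det (Q g)) \<longlongrightarrow> det (Q (mat 1))) (nhds (mat 1))"
    unfolding det_def Q_def by (auto intro!: tendsto_intros filterlim_ident)
  have conts: "((\<lambda>g. s g k) \<longlongrightarrow> s (mat 1) k) (nhds (mat 1))" for k
    unfolding s_def
  proof (rule tendsto_divide[OF _ contQ])
    show "((\<lambda>g. det (\<chi> i j. if j = k then 1 else Q g $ i $ j)) \<longlongrightarrow>
      det (\<chi> i j. if j = k then 1 else Q (mat 1) $ i $ j)) (nhds (mat 1))"
      unfolding det_def Q_def
      by (intro tendsto_sum tendsto_mult tendsto_const tendsto_prod)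
        (auto intro!: tendsto_intros filterlim_ident)
  qed (simp add: Q1)
  have solves: "Q g *v (\<chi> k. s g k) = (\<chi> k. 1)" if "det (Q g) \<noteq> 0" for g
    using cramer[OF that, of "\<chi> k. s g k" "\<chi> k. 1"] by (simp add: s_def cong: if_cong)
  have s1: "s (mat 1) k = 1" for k
    using solves[of "mat 1"] by (simp add: Q1 vec_eq_iff)
  define e where "e = 1 / (10 * (real CARD('n))\<^sup>2)"
  have e: "e > 0" by (simp add: e_def)
  \<comment> \<open>Three open conditions that hold at the identity: the system is nonsingular, its
    solution is positive so that square roots give a positive diagonal, and the rescaled matrix
    meets the tolerance of \<open>balanced_near_identity\<close>.\<close>
  have ev1: "\<forall>\<^sub>F g in nhds (mat 1). det (Q g) > 0"
    using contQ by (rule order_tendstoD) (simp add: Q1)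
  have ev2: "\<forall>\<^sub>F g in nhds (mat 1). \<forall>k. s g k > 0"
    using conts s1 by (auto intro!: eventually_all_finite order_tendstoD(1)[of _ "1"])
  have ev3: "\<forall>\<^sub>F g in nhds (mat 1). \<forall>i j. dist (sqrt (s g i) * g $ i $ j) (mat 1 $ i $ j) < e"
  proof (intro eventually_all_finite)
    fix i j
    have "((\<lambda>g. sqrt (s g i) * g $ i $ j) \<longlongrightarrow> sqrt (s (mat 1) i) * mat 1 $ i $ j) (nhds (mat 1))"
      by (intro tendsto_intros conts filterlim_ident)
    then show "\<forall>\<^sub>F g in nhds (mat 1). dist (sqrt (s g i) * g $ i $ j) (mat 1 $ i $ j) < e"
      using e by (auto simp: s1 tendsto_iff)
  qed
  have good: "\<exists>d. (\<forall>i. d i > 0) \<and> balanced (diagm d ** g)"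
    if *: "det (Q g) > 0" "\<forall>k. s g k > 0" "\<forall>i j. dist (sqrt (s g i) * g $ i $ j) (mat 1 $ i $ j) < e" for g
  proof (intro exI conjI allI)
    show "sqrt (s g i) > 0" for i using * by simp
    show "balanced (diagm (\<lambda>i. sqrt (s g i)) ** g)"
    proof (rule balanced_near_identity)
      show "\<bar>(diagm (\<lambda>i. sqrt (s g i)) ** g - mat 1) $ i $ j\<bar> \<le> 1 / real (10 * CARD('n)\<^sup>2)" for i j
        using *(3) by (auto simp: diagm_mult_nth dist_real_def e_def less_imp_le)
      show "norm (diagm (\<lambda>i. sqrt (s g i)) ** g *v axis i 1) = 1" for i
      proof -
        have "(norm (diagm (\<lambda>i. sqrt (s g i)) ** g *v axis i 1))\<^sup>2 = (\<Sum>j\<in>UNIV. s g j * (g $ j $ i)\<^sup>2)"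
          using *(2) by (simp add: matrix_vector_mult_basis column_def norm_vec_def L2_set_def sum_nonneg
            diagm_mult_nth power_mult_distrib less_imp_le)
        also have "\<dots> = (Q g *v (\<chi> k. s g k)) $ i"
          by (simp add: matrix_vector_mult_def Q_def mult.commute)
        also have "\<dots> = 1" using solves[of g] *(1) by simp
        finally show ?thesis by (metis norm_ge_zero one_power2 power2_eq_iff_nonneg zero_le_one)
      qed
    qed
  qed
  from ev1 ev2 ev3 have "\<forall>\<^sub>F g in nhds (mat 1 :: real^'n^'n). \<exists>d. (\<forall>i. d i > 0) \<and> balanced (diagm d ** g)"
    by eventually_elim (use good in blast)
  then show thesis unfolding eventually_nhds using that by blast
qed

section \<open>Generation by transvections and diagonal matrices\<close>

text \<open>Gaussian elimination carried out inside determinant 1. It reduces a multiplicative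
  property of the whole group to the two kinds of generators.\<close>

lemma SL_elementary_induct [consumes 1, case_names mult diag transvection]:
  fixes A :: "real^'n^'n"
  assumes "det A = 1"
    and mult: "\<And>A B. P A \<Longrightarrow> P B \<Longrightarrow> P (A ** B)"
    and diag: "\<And>d. prod d UNIV = 1 \<Longrightarrow> P (diagm d)"
    and transv: "\<And>m n c. m \<noteq> n \<Longrightarrow> P (transvection m n c)"
  shows "P A"
proof -
  \<comment> \<open>The elementary factors of \<open>A\<close> need not have determinant 1, hence the diagonal corrections.\<close>
  define Q where "Q A \<longleftrightarrow> (\<forall>d d'. det (diagm d ** A ** diagm d') = 1 \<longrightarrow> P (diagm d ** A ** diagm d'))"
    for A
  have Q_mult: "Q (A ** B)" if AB: "Q A" "Q B" for A B
    unfolding Q_def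
  proof (intro allI impI)
    fix d d'
    assume det: "det (diagm d ** (A ** B) ** diagm d') = 1"
    define \<delta> where "\<delta> = det (diagm d ** A)"
    have \<delta>: "\<delta> \<noteq> 0" using det by (auto simp: \<delta>_def det_mul)
    obtain k :: 'n where True by blast
    \<comment> \<open>A mutually inverse pair inserted between the factors; one arbitrary coordinate
      \<open>k\<close> absorbs the determinant, so that both factors get determinant 1.\<close>
    define e e' where "e i = (if i = k then 1 / \<delta> else 1)" and "e' i = (if i = k then \<delta> else 1)" for i
    have ee': "diagm e ** diagm e' = mat 1"
      using \<delta> by (simp add: diagm_mult_diagm e_def e'_def flip: diagm_one) (rule arg_cong[where f=diagm], auto)
    have split: "diagm d ** (A ** B) ** diagm d' = (diagm d ** A ** diagm e) ** (diagm e' ** B ** diagm d')"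
    proof -
      have "(diagm d ** A ** diagm e) ** (diagm e' ** B ** diagm d')
        = diagm d ** A ** (diagm e ** diagm e') ** (B ** diagm d')"
        by (simp only: matrix_mul_assoc)
      then show ?thesis unfolding ee' by (simp only: matrix_mul_assoc matrix_mul_rid)
    qed
    have 1: "det (diagm d ** A ** diagm e) = 1"
      using \<delta> by (simp add: det_mul[of _ "diagm e"] \<delta>_def[symmetric] det_diagm e_def)
    then have "det (diagm e' ** B ** diagm d') = 1"
      using det unfolding split by (simp add: det_mul)
    with 1 show "P (diagm d ** (A ** B) ** diagm d')"
      unfolding split using AB by (auto simp: Q_def intro: mult)
  qed
  have Q_diag: "Q (diagm a)" for a
    unfolding Q_def diagm_mult_diagm det_diagm using diag by auto
  have Q_transv: "Q (transvection m n c)" if "m \<noteq> n" for m n c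
    unfolding Q_def
  proof (intro allI impI)
    fix d d'
    assume "det (diagm d ** transvection m n c ** diagm d') = 1"
    then have prod: "prod (\<lambda>i. d i * d' i) UNIV = 1"
      by (simp add: det_mul det_diagm det_transvection[OF that] prod.distrib)
    have "d i \<noteq> 0" for i using prod_eq_1_nonzero[OF prod, of i] by auto
    \<comment> \<open>Completing the left factor to a conjugation leaves a transvection times a
      diagonal matrix of determinant 1.\<close>
    then have "diagm d ** transvection m n c ** diagm d'
        = (diagm d ** transvection m n c ** diagm (\<lambda>i. 1 / d i)) ** diagm (\<lambda>i. d i * d' i)"
      by (simp add: vec_eq_iff mult_diagm_nth)
    also have "\<dots> = transvection m n (d m * c * (1 / d n)) ** diagm (\<lambda>i. d i * d' i)"
      using \<open>\<And>i. d i \<noteq> 0\<close> by (subst diagm_transvection[OF that]) auto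
    finally show "P (diagm d ** transvection m n c ** diagm d')"
      using mult transv[OF that] diag[OF prod] by metis
  qed
  have "Q A"
  proof (rule induct_matrix_elementary)
    show "Q A" if "row i A = 0" for A i
    proof -
      \<comment> \<open>Singular matrices satisfy \<open>Q\<close> vacuously.\<close>
      have "det A = 0" using that by (rule det_zero_row)
      then show ?thesis by (simp add: Q_def det_mul)
    qed
    show "Q A" if "\<And>i j. i \<noteq> j \<Longrightarrow> A $ i $ j = 0" for A
    proof -
      have "A = diagm (\<lambda>i. A $ i $ i)" using that by (auto simp: diagm_def vec_eq_iff)
      then show ?thesis using Q_diag by metis
    qed
    show "Q (\<chi> i j. mat 1 $ i $ Transposition.transpose m n j)" if "m \<noteq> n" for m n
      using that unfolding swap_eq_transvections[OF that] by (auto intro!: Q_mult Q_diag Q_transv)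
    show "Q (\<chi> i j. if i = m \<and> j = n then c else of_bool (i = j))" if "m \<noteq> n" for m n c
      using Q_transv[OF that] by (simp add: transvection_def)
  qed (rule Q_mult)
  then have "det (diagm (\<lambda>_. 1) ** A ** diagm (\<lambda>_. 1)) = 1 \<longrightarrow> P (diagm (\<lambda>_. 1) ** A ** diagm (\<lambda>_. 1))"
    unfolding Q_def by blast
  then show ?thesis using assms(1) by (simp add: diagm_one)
qed

section \<open>Cosets, translations and saturated sets of lattices\<close>

lemma translate_translate: "translate a (translate b x) = translate (a ** b) x"
  by (simp add: translate_def image_image matrix_mul_assoc)

lemma translate_mat_1: "translate (mat 1) x = x"
  by (simp add: translate_def)

lemma SL_real_mult: "a \<in> SL_real \<Longrightarrow> b \<in> SL_real \<Longrightarrow> a ** b \<in> SL_real"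
  by (simp add: SL_real_def det_mul)

lemma translate_lattice_space: "g \<in> SL_real \<Longrightarrow> x \<in> lattice_space \<Longrightarrow> translate g x \<in> lattice_space"
  by (auto simp: lattice_space_def translate_coset SL_real_mult)

lemma SL_int_mult: "a \<in> SL_int \<Longrightarrow> b \<in> SL_int \<Longrightarrow> a ** b \<in> SL_int"
  by (auto simp: SL_int_def SL_real_mult) (auto simp: matrix_matrix_mult_def intro!: Ints_sum Ints_mult)

lemma mat_1_SL_int: "mat 1 \<in> SL_int"
  by (simp add: SL_int_def SL_real_def) (simp add: mat_def)

lemma SL_real_inverse:
  assumes "g \<in> SL_real"
  obtains g' where "g' \<in> SL_real" "g' ** g = mat 1" "g ** g' = mat 1"
proof -
  from assms have "invertible g" by (simp add: SL_real_def invertible_det_nz)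
  then obtain g' where g': "g ** g' = mat 1" "g' ** g = mat 1" by (auto simp: invertible_def)
  moreover have "det g' = 1"
    using assms arg_cong[OF g'(1), of det] by (simp add: det_mul SL_real_def)
  ultimately show thesis using that by (simp add: SL_real_def)
qed

text \<open>By Cramer's rule the entries of the inverse are determinants of integer matrices divided
  by \<open>det g = 1\<close>.\<close>

lemma SL_int_inverse:
  assumes "g \<in> SL_int"
  obtains g' where "g' \<in> SL_int" "g ** g' = mat 1"
proof -
  obtain g' where g': "g' \<in> SL_real" "g ** g' = mat 1"
    using assms SL_real_inverse[of g] unfolding SL_int_def by blast
  have dg: "det g = 1" using assms by (simp add: SL_int_def SL_real_def)
  have "g' $ i $ j \<in> \<int>" for i j
  proof -
    have "g *v column j g' = axis j 1"
      using g'(2) by (metis matrix_vector_mul_assoc matrix_vector_mul_lid matrix_vector_mult_basis)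
    then have "column j g' = (\<chi> k. det (\<chi> i l. if l = k then axis j 1 $ i else g $ i $ l) / det g)"
      using cramer[of g "column j g'" "axis j 1"] dg by simp
    then have "g' $ i $ j = det (\<chi> i' l. if l = i then axis j 1 $ i' else g $ i' $ l)"
      by (simp add: vec_eq_iff column_def dg)
    also have "\<dots> \<in> \<int>"
      using assms by (auto simp: det_def SL_int_def axis_def intro!: Ints_sum Ints_mult Ints_prod)
    finally show ?thesis .
  qed
  then show thesis using that g' by (auto simp: SL_int_def)
qed

lemma coset_mult_SL_int:
  assumes "\<gamma> \<in> SL_int"
  shows "coset (g ** \<gamma>) = coset g"
proof
  show "coset (g ** \<gamma>) \<subseteq> coset g"
    using assms by (auto simp: coset_def SL_int_mult simp flip: matrix_mul_assoc)
  obtain \<delta> where \<delta>: "\<delta> \<in> SL_int" "\<gamma> ** \<delta> = mat 1" using SL_int_inverse[OF assms] by blast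
  show "coset g \<subseteq> coset (g ** \<gamma>)"
  proof
    fix h assume "h \<in> coset g"
    then obtain \<eta> where "\<eta> \<in> SL_int" "h = g ** \<eta>" by (auto simp: coset_def)
    then have "h = (g ** \<gamma>) ** (\<delta> ** \<eta>)" "\<delta> ** \<eta> \<in> SL_int"
      using \<delta> by (metis matrix_mul_assoc matrix_mul_rid, simp add: SL_int_mult)
    then show "h \<in> coset (g ** \<gamma>)" by (auto simp: coset_def)
  qed
qed

text \<open>The diagonal factor may have negative entries. These do not affect lengths of vectors, and
  with them the saturation is invariant under every diagonal matrix of determinant 1, which matters
  because reducing a matrix to transvections leaves such a diagonal factor behind.\<close>

definition saturation :: "(real^'n^'n) set \<Rightarrow> (real^'n^'n) set set" where
  "saturation N = {coset g | g d \<gamma>. g \<in> SL_real \<and> prod d UNIV = 1 \<and> \<gamma> \<in> SL_int \<and> diagm d ** g ** \<gamma> \<in> N}"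

text \<open>Membership can be tested on any representative: two of them differ by an element of
  \<open>SL_int\<close>, which is absorbed into \<gamma>.\<close>

lemma coset_in_saturation_iff:
  assumes "g \<in> SL_real"
  shows "coset g \<in> saturation N \<longleftrightarrow> (\<exists>d \<gamma>. prod d UNIV = 1 \<and> \<gamma> \<in> SL_int \<and> diagm d ** g ** \<gamma> \<in> N)"
proof
  assume "coset g \<in> saturation N"
  then obtain h d \<gamma> where h: "coset g = coset h" "prod d UNIV = 1" "\<gamma> \<in> SL_int" "diagm d ** h ** \<gamma> \<in> N"
    unfolding saturation_def by auto
  have "h ** mat 1 \<in> coset h" unfolding coset_def using mat_1_SL_int by blast
  then have "h \<in> coset g" by (simp add: h(1))
  then obtain \<delta> where "\<delta> \<in> SL_int" "h = g ** \<delta>" by (auto simp: coset_def)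
  then have "diagm d ** g ** (\<delta> ** \<gamma>) \<in> N" "\<delta> ** \<gamma> \<in> SL_int"
    using h by (auto simp: matrix_mul_assoc SL_int_mult)
  then show "\<exists>d \<gamma>. prod d UNIV = 1 \<and> \<gamma> \<in> SL_int \<and> diagm d ** g ** \<gamma> \<in> N"
    using h(2) by blast
qed (use assms in \<open>auto simp: saturation_def\<close>)

lemma saturation_subset: "saturation N \<subseteq> lattice_space"
  by (auto simp: saturation_def lattice_space_def)

lemma continuous_on_matrix_mult_both: "continuous_on S (\<lambda>g :: real^'n^'n. A ** g ** B)"
  unfolding matrix_matrix_mult_def by (intro continuous_intros)

text \<open>The preimage is cut out by a union of preimages of \<open>N\<close> under the continuous
  maps \<open>\<lambda>g. diagm d ** g ** \<gamma>\<close>.\<close>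

lemma openin_saturation:
  assumes "open N"
  shows "openin (top_of_set SL_real) {g \<in> SL_real. coset g \<in> saturation N}"
proof -
  have "{g \<in> SL_real. coset g \<in> saturation N}
    = SL_real \<inter> (\<Union>d\<in>{d. prod d UNIV = 1}. \<Union>\<gamma>\<in>SL_int. (\<lambda>g. diagm d ** g ** \<gamma>) -` N)"
    by (auto simp: coset_in_saturation_iff) blast+
  moreover have "open (\<Union>d\<in>{d. prod d UNIV = 1}. \<Union>\<gamma>\<in>SL_int. (\<lambda>g. diagm d ** g ** \<gamma>) -` N)"
    by (intro open_UN ballI open_vimage assms continuous_on_matrix_mult_both)
  ultimately show ?thesis by auto
qed

lemma translate_diagm_saturation:
  assumes "prod d UNIV = 1" "x \<in> saturation N"
  shows "translate (diagm d) x \<in> saturation N"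
proof -
  obtain g e \<gamma> where g: "x = coset g" "g \<in> SL_real" "prod e UNIV = 1" "\<gamma> \<in> SL_int" "diagm e ** g ** \<gamma> \<in> N"
    using assms(2) by (auto simp: saturation_def)
  have nz: "d i \<noteq> 0" for i by (rule prod_eq_1_nonzero[OF assms(1)])
  have "diagm (\<lambda>i. e i / d i) ** (diagm d ** g) ** \<gamma> = diagm e ** g ** \<gamma>"
    using nz by (simp add: matrix_mul_assoc diagm_mult_diagm)
  moreover have "prod (\<lambda>i. e i / d i) UNIV = 1" using g assms by (simp add: prod_dividef)
  moreover have "diagm d ** g \<in> SL_real" using g assms by (simp add: SL_real_def det_mul det_diagm)
  ultimately show ?thesis
    unfolding g(1) translate_coset using g by (metis coset_in_saturation_iff)
qed

lemma translate_diagm_saturation_iff: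
  assumes "prod d UNIV = 1"
  shows "translate (diagm d) x \<in> saturation N \<longleftrightarrow> x \<in> saturation N"
proof
  assume *: "translate (diagm d) x \<in> saturation N"
  have nz: "d i \<noteq> 0" for i by (rule prod_eq_1_nonzero[OF assms(1)])
  have "translate (diagm (\<lambda>i. 1 / d i)) (translate (diagm d) x) \<in> saturation N"
    by (rule translate_diagm_saturation[OF _ *]) (simp add: prod_dividef assms)
  then show "x \<in> saturation N"
    using nz by (simp add: translate_translate diagm_mult_diagm diagm_one translate_mat_1)
qed (rule translate_diagm_saturation[OF assms])

section \<open>Measurability, null sets and the Mautner argument\<close>

lemma space_lattice_borel: "space lattice_borel = lattice_space"
  by (auto simp: lattice_borel_def space_measure_of_conv)

lemma saturation_sets: "open N \<Longrightarrow> saturation N \<in> sets lattice_borel"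
  unfolding lattice_borel_def
  by (rule in_measure_of) (auto simp: openin_saturation dest: subsetD[OF saturation_subset])

lemma measurable_translate:
  assumes "g \<in> SL_real"
  shows "translate g \<in> measurable lattice_borel lattice_borel"
  unfolding lattice_borel_def
proof (rule measurable_measure_of, goal_cases)
  case 2
  then show ?case using translate_lattice_space[OF assms] by (auto simp: space_measure_of_conv)
next
  case (3 U)
  have "continuous_on SL_real (\<lambda>h. g ** h ** mat 1)" by (rule continuous_on_matrix_mult_both)
  then have cont: "continuous_on SL_real (\<lambda>h. g ** h)" by simp
  have "openin (top_of_set SL_real) (SL_real \<inter> (\<lambda>h. g ** h) -` {h \<in> SL_real. coset h \<in> U})"
    using 3 assms by (intro continuous_openin_preimage[OF cont, of SL_real]) (auto intro: SL_real_mult)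
  also have "SL_real \<inter> (\<lambda>h. g ** h) -` {h \<in> SL_real. coset h \<in> U}
    = {h \<in> SL_real. coset h \<in> translate g -` U \<inter> lattice_space}"
    using assms by (auto simp: translate_coset SL_real_mult lattice_space_def)
  finally show ?case by (auto simp: space_measure_of_conv intro!: in_measure_of)
qed auto

lemma invariant_prob_measurable_translate:
  assumes "invariant_prob M" "g \<in> SL_real"
  shows "translate g \<in> measurable M M"
  using assms measurable_translate[OF assms(2)] measurable_cong_sets[of M lattice_borel M lattice_borel]
  by (simp add: invariant_prob_def)

lemma invariant_prob_saturation_sets:
  "invariant_prob M \<Longrightarrow> open N \<Longrightarrow> saturation N \<in> sets M"
  by (simp add: invariant_prob_def saturation_sets)

text \<open>The tail unions decrease, and their intersection is empty since every point eventually
  leaves the sets; continuity from above applies to them.\<close>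

lemma (in finite_measure) measure_tendsto_0_pointwise:
  assumes C: "\<And>k::nat. C k \<in> sets M" and ev: "\<And>x. x \<in> space M \<Longrightarrow> \<forall>\<^sub>F k in sequentially. x \<notin> C k"
  shows "(\<lambda>k. measure M (C k)) \<longlonglongrightarrow> 0"
proof (rule tendsto_sandwich[where f="\<lambda>_. 0" and h="\<lambda>k. measure M (\<Union>m\<in>{k..}. C m)"])
  let ?F = "\<lambda>k. \<Union>m\<in>{k..}. C m"
  have "(\<Inter>k. ?F k) = {}"
  proof (rule equals0I)
    fix x assume x: "x \<in> (\<Inter>k. ?F k)"
    then have "x \<in> space M" using sets.sets_into_space[OF C] by blast
    from ev[OF this] show False using x by (auto simp: eventually_sequentially)
  qed
  moreover have "(\<lambda>k. measure M (?F k)) \<longlonglongrightarrow> measure M (\<Inter>k. ?F k)"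
    by (rule finite_Lim_measure_decseq) (use C in \<open>auto simp: decseq_def intro: order_trans\<close>)
  ultimately show "(\<lambda>k. measure M (?F k)) \<longlonglongrightarrow> 0" by simp
  show "\<forall>\<^sub>F k in sequentially. measure M (C k) \<le> measure M (?F k)"
    using C by (intro always_eventually allI finite_measure_mono) auto
qed auto

text \<open>Invariance is formulated for images, whereas null sets are pulled back here; the image
  of the preimage of \<open>Z\<close> lies in \<open>Z\<close>, so the preimage is null.\<close>

lemma invariant_prob_AE_translate:
  assumes M: "invariant_prob M" and g: "g \<in> SL_real" and P: "AE x in M. P x"
  shows "AE x in M. P (translate g x)"
proof -
  have meas: "translate g \<in> measurable M M"
    using M g by (rule invariant_prob_measurable_translate)
  from P obtain Z where Z: "{x \<in> space M. \<not> P x} \<subseteq> Z" "Z \<in> null_sets M"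
    by (auto simp: eventually_ae_filter)
  let ?B = "translate g -` Z \<inter> space M"
  have B: "?B \<in> sets M" using meas Z by (auto intro: measurable_sets)
  have "emeasure M ?B = emeasure M (translate g ` ?B)"
    using M g B by (simp add: invariant_prob_def)
  also have "\<dots> \<le> emeasure M Z" using Z by (intro emeasure_mono) auto
  finally have "emeasure M ?B = 0" using null_setsD1[OF Z(2)] by simp
  then have "?B \<in> null_sets M" using B by (rule null_setsI)
  moreover have "{x \<in> space M. \<not> P (translate g x)} \<subseteq> ?B"
    using Z measurable_space[OF meas] by auto
  ultimately show ?thesis by (rule AE_I')
qed

lemma tendsto_transvection:
  assumes "m \<noteq> n" "(c \<longlongrightarrow> 0) F"
  shows "((\<lambda>k. transvection m n (c k)) \<longlongrightarrow> mat 1) F"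
  unfolding transvection_zero[OF assms(1), symmetric]
proof (intro vec_tendstoI)
  fix i j
  show "((\<lambda>k. transvection m n (c k) $ i $ j) \<longlongrightarrow> transvection m n 0 $ i $ j) F"
    using assms(2) by (cases "i = m"; cases "j = n") (simp_all add: transvection_def)
qed

text \<open>For a fixed point of the saturation, openness of \<open>N\<close> keeps
  \<open>diagm d ** v k ** g ** \<gamma>\<close> in \<open>N\<close> for all large \<open>k\<close>,
  so each point escapes only finitely often.\<close>

lemma measure_saturation_escape:
  fixes M :: "(real^'n^'n) set measure"
  assumes M: "invariant_prob M" and N: "open N"
    and v: "\<And>k. v k \<in> SL_real" "v \<longlonglongrightarrow> mat 1"
  shows "(\<lambda>k. measure M {x \<in> saturation N. translate (v k) x \<notin> saturation N}) \<longlonglongrightarrow> 0"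
proof -
  interpret prob_space M using M by (simp add: invariant_prob_def)
  have meas: "translate (v k) \<in> measurable M M" for k
    using M v(1) by (rule invariant_prob_measurable_translate)
  have V: "saturation N \<in> sets M" using M N by (rule invariant_prob_saturation_sets)
  show ?thesis
  proof (rule measure_tendsto_0_pointwise)
    fix k
    have "{x \<in> saturation N. translate (v k) x \<notin> saturation N}
       = saturation N - (translate (v k) -` saturation N \<inter> space M)"
      using sets.sets_into_space[OF V] by auto
    then show "{x \<in> saturation N. translate (v k) x \<notin> saturation N} \<in> sets M"
      using V measurable_sets[OF meas V] by auto
  next
    fix x
    show "\<forall>\<^sub>F k in sequentially. x \<notin> {x \<in> saturation N. translate (v k) x \<notin> saturation N}"
    proof (cases "x \<in> saturation N")
      case True
      then obtain g d \<gamma> where g: "x = coset g" "g \<in> SL_real" "prod d UNIV = 1" "\<gamma> \<in> SL_int"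
          "diagm d ** g ** \<gamma> \<in> N"
        by (auto simp: saturation_def)
      have "(\<lambda>k. diagm d ** v k ** (g ** \<gamma>)) \<longlonglongrightarrow> diagm d ** mat 1 ** (g ** \<gamma>)"
        by (rule continuous_on_tendsto_compose[OF continuous_on_matrix_mult_both[of UNIV] v(2)]) auto
      moreover have "diagm d ** mat 1 ** (g ** \<gamma>) \<in> N" using g(5) by (simp add: matrix_mul_assoc)
      ultimately have "\<forall>\<^sub>F k in sequentially. diagm d ** v k ** (g ** \<gamma>) \<in> N"
        by (rule topological_tendstoD[OF _ N])
      then show ?thesis
      proof eventually_elim
        case (elim k)
        then have "diagm d ** (v k ** g) ** \<gamma> \<in> N" by (simp add: matrix_mul_assoc)
        then have "translate (v k) x \<in> saturation N"
          using g v(1) by (auto simp: translate_coset coset_in_saturation_iff SL_real_mult)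
        then show ?case by simp
      qed
    qed simp
  qed
qed

text \<open>The Mautner phenomenon: conjugation by diagonal matrices contracts a transvection to the
  identity without affecting the saturation.\<close>

lemma AE_transvection_saturation:
  fixes M :: "(real^'n^'n) set measure"
  assumes M: "invariant_prob M" and N: "open N" and mn: "m \<noteq> n"
  shows "AE x in M. translate (transvection m n c) x \<in> saturation N \<longrightarrow> x \<in> saturation N"
proof -
  interpret prob_space M using M by (simp add: invariant_prob_def)
  let ?u = "transvection m n"
  have u: "?u c \<in> SL_real" for c by (simp add: SL_real_def det_transvection[OF mn])
  have meas: "translate g \<in> measurable M M" if "g \<in> SL_real" for g
    using M that by (rule invariant_prob_measurable_translate)
  have V: "saturation N \<in> sets M" using M N by (rule invariant_prob_saturation_sets)
  define B where "B = {x \<in> space M. translate (?u c) x \<in> saturation N \<and> x \<notin> saturation N}"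
  have "B = (translate (?u c) -` saturation N \<inter> space M) - saturation N" by (auto simp: B_def)
  then have B: "B \<in> sets M" using V measurable_sets[OF meas[OF u] V] by auto
  \<comment> \<open>The factor \<open>(1/4)^k\<close> is \<open>d m * e n\<close> for the
    conjugating matrices \<open>d\<close> and \<open>e\<close> chosen below.\<close>
  define v where "v k = ?u (- c * (1/4)^k)" for k :: nat
  have v: "v k \<in> SL_real" for k by (simp add: v_def u)
  let ?C = "\<lambda>k. {x \<in> saturation N. translate (v k) x \<notin> saturation N}"
  have "(\<lambda>k. - c * (1/4)^k) \<longlonglongrightarrow> - c * 0"
    by (intro tendsto_intros LIMSEQ_power_zero) auto
  then have "v \<longlonglongrightarrow> mat 1" unfolding v_def by (intro tendsto_transvection[OF mn]) simp
  from measure_saturation_escape[OF M N v this] have lim: "(\<lambda>k. measure M (?C k)) \<longlonglongrightarrow> 0" .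
  have le: "measure M B \<le> measure M (?C k)" for k
  proof -
    \<comment> \<open>Shrinking coordinate \<open>m\<close> and expanding \<open>n\<close> at the
      same rate keeps the determinant 1; \<open>e\<close> is the inverse of
      \<open>d\<close>.\<close>
    define d e :: "'n \<Rightarrow> real" where "d i = (if i = m then (1/2)^k else if i = n then 2^k else 1)"
      and "e i = (if i = m then 2^k else if i = n then (1/2)^k else 1)" for i
    have "prod d UNIV = d m * (d n * prod d (UNIV - {m} - {n}))"
      using mn by (metis DiffI UNIV_I finite finite_Diff prod.remove singletonD)
    also have "prod d (UNIV - {m} - {n}) = 1" by (rule prod.neutral) (auto simp: d_def)
    finally have d: "prod d UNIV = 1" using mn by (simp add: d_def power_one_over)
    have de: "d i * e i = 1" for i by (simp add: d_def e_def power_one_over)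
    have vk: "v k = diagm d ** ?u (- c) ** diagm e"
      using mn by (subst diagm_transvection[OF mn de])
        (simp add: v_def d_def e_def ac_simps flip: power_mult_distrib)
    have dS: "diagm d \<in> SL_real" by (simp add: SL_real_def det_diagm d)
    have "emeasure M B = emeasure M (translate (diagm d ** ?u c) ` B)"
      using M B SL_real_mult[OF dS u] by (simp add: invariant_prob_def)
    also have "\<dots> \<le> emeasure M (?C k)"
    proof (rule emeasure_mono)
      show "translate (diagm d ** ?u c) ` B \<subseteq> ?C k"
      proof safe
        fix x assume x: "x \<in> B"
        then show "translate (diagm d ** ?u c) x \<in> saturation N"
          by (simp add: B_def translate_diagm_saturation_iff[OF d] flip: translate_translate)
        assume *: "translate (v k) (translate (diagm d ** ?u c) x) \<in> saturation N"
        \<comment> \<open>The product collapses to \<open>diagm d\<close>. Applying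
          \<open>v k\<close> thus takes the point to \<open>translate (diagm d) x\<close>, which is
          outside the saturation because \<open>x\<close> is.\<close>
        have "v k ** (diagm d ** ?u c) = diagm d ** ?u (-c) ** (diagm e ** diagm d) ** ?u c"
          by (simp add: vk matrix_mul_assoc)
        also have "diagm e ** diagm d = mat 1"
          using de by (simp add: diagm_mult_diagm mult.commute diagm_one)
        also have "diagm d ** ?u (-c) ** mat 1 ** ?u c = diagm d"
          by (simp add: transvection_mult_transvection[OF mn] transvection_zero[OF mn] flip: matrix_mul_assoc)
        finally show False
          using * x by (simp add: translate_translate translate_diagm_saturation_iff[OF d] B_def)
      qed
      have "?C k = saturation N - (translate (v k) -` saturation N \<inter> space M)"
        using sets.sets_into_space[OF V] by auto
      then show "?C k \<in> sets M" using V measurable_sets[OF meas[OF v] V] by auto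
    qed
    finally show ?thesis by (simp add: emeasure_eq_measure)
  qed
  have "measure M B \<le> 0" using lim by (rule tendsto_lowerbound) (use le in auto)
  then have "measure M B = 0" using measure_nonneg[of M B] by linarith
  then have "B \<in> null_sets M" using B by (auto simp: emeasure_eq_measure intro: null_setsI)
  then show ?thesis by (rule AE_I') (auto simp: B_def)
qed

text \<open>The property passes to products: the exceptional set for \<open>A\<close>, pulled back
  along translation by \<open>B\<close>, is still null.\<close>

lemma AE_translate_saturation:
  fixes M :: "(real^'n^'n) set measure"
  assumes M: "invariant_prob M" and N: "open N" and g: "g \<in> SL_real"
  shows "AE x in M. translate g x \<in> saturation N \<longrightarrow> x \<in> saturation N"
proof -
  let ?P = "\<lambda>g. g \<in> SL_real \<and> (AE x in M. translate g x \<in> saturation N \<longrightarrow> x \<in> saturation N)"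
  have "det g = 1" using g by (simp add: SL_real_def)
  then have "?P g"
  proof (induction rule: SL_elementary_induct)
    case (mult A B)
    then have B: "B \<in> SL_real"
      and AE: "AE x in M. translate A x \<in> saturation N \<longrightarrow> x \<in> saturation N"
        "AE x in M. translate B x \<in> saturation N \<longrightarrow> x \<in> saturation N" by auto
    from invariant_prob_AE_translate[OF M B AE(1)] AE(2)
    have "AE x in M. translate (A ** B) x \<in> saturation N \<longrightarrow> x \<in> saturation N"
      by eventually_elim (auto simp: translate_translate)
    then show ?case using mult by (auto simp: SL_real_mult)
  next
    case (diag d)
    then show ?case by (simp add: translate_diagm_saturation_iff SL_real_def det_diagm)
  next
    case (transvection m n c)
    then show ?case using AE_transvection_saturation[OF M N] by (simp add: SL_real_def det_transvection)
  qed
  then show ?thesis by simp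
qed

section \<open>Full measure and well-rounded lattices in diagonal orbits\<close>

lemma AE_in_saturation:
  fixes M :: "(real^'n^'n) set measure"
  assumes M: "invariant_prob M" and N: "open N" "mat 1 \<in> N"
  shows "AE x in M. x \<in> saturation N"
proof -
  obtain D :: "(real^'n^'n) set" where D: "countable D" "D \<subseteq> SL_real" "SL_real \<subseteq> closure D"
    using separable by blast
  have "AE x in M. \<forall>g\<in>D. translate g x \<in> saturation N \<longrightarrow> x \<in> saturation N"
    using D AE_translate_saturation[OF M N(1)] by (intro AE_ball_countable') auto
  moreover have "\<exists>g\<in>D. translate g x \<in> saturation N" if x: "x \<in> lattice_space" for x
  proof -
    obtain h where h: "x = coset h" "h \<in> SL_real" using x by (auto simp: lattice_space_def)
    obtain h' where h': "h' \<in> SL_real" "h' ** h = mat 1" using SL_real_inverse[OF h(2)] by blast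
    \<comment> \<open>Elements of \<open>D\<close> close enough to the inverse of \<open>h\<close>
      carry \<open>h\<close> into \<open>N\<close>, as \<open>N\<close> is a neighbourhood of the
      identity.\<close>
    have "open ((\<lambda>g. mat 1 ** g ** h) -` N)"
      by (intro open_vimage N continuous_on_matrix_mult_both)
    moreover have "h' \<in> (\<lambda>g. mat 1 ** g ** h) -` N" using h' N by simp
    ultimately have "(\<lambda>g. mat 1 ** g ** h) -` N \<inter> D \<noteq> {}"
      using D(3) h'(1) open_Int_closure_eq_empty by blast
    then obtain g where g: "g \<in> D" "g ** h \<in> N" by auto
    then have "g ** h \<in> SL_real" using D h by (auto intro: SL_real_mult)
    then have "coset (g ** h) \<in> saturation N"
      unfolding coset_in_saturation_iff[OF \<open>g ** h \<in> SL_real\<close>] using g mat_1_SL_int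
      by (intro exI[of _ "\<lambda>_. 1"] exI[of _ "mat 1"]) (simp add: diagm_one)
    then show ?thesis using g h by (auto simp: translate_coset)
  qed
  moreover have "space M = lattice_space"
    using M sets_eq_imp_space_eq[of M lattice_borel] by (simp add: invariant_prob_def space_lattice_borel)
  ultimately show ?thesis by auto
qed

theorem proposition2p2:
  fixes M :: "(real^'n^'n) set measure"
  assumes "CARD('n) \<ge> 2"
    and "invariant_prob M"
  shows "AE x in M. \<exists>y\<in>diag_orbit x. well_rounded y"
proof -
  obtain N :: "(real^'n^'n) set" where N: "open N" "mat 1 \<in> N"
    and bal: "\<And>g. g \<in> N \<Longrightarrow> \<exists>d. (\<forall>i. d i > 0) \<and> balanced (diagm d ** g)"
    using exists_balancing_neighbourhood by metis
  have "\<exists>y\<in>diag_orbit x. well_rounded y" if "x \<in> saturation N" for x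
  proof -
    obtain g t \<gamma> where g: "x = coset g" "g \<in> SL_real" "prod t UNIV = 1" "\<gamma> \<in> SL_int" "diagm t ** g ** \<gamma> \<in> N"
      using \<open>x \<in> saturation N\<close> by (auto simp: saturation_def)
    obtain d where d: "\<And>i. d i > 0" "balanced (diagm d ** (diagm t ** g ** \<gamma>))"
      using bal[OF g(5)] by blast
    have t: "t i \<noteq> 0" for i by (rule prod_eq_1_nonzero[OF g(3)])
    define p where "p = prod d UNIV"
    have p: "p > 0" using d by (simp add: p_def prod_pos)
    \<comment> \<open>The scaling that restores determinant 1.\<close>
    define c where "c = root CARD('n) (1 / p)"
    have c: "c > 0" "c ^ CARD('n) = 1 / p" using p by (simp_all add: c_def real_root_pow_pos2)
    \<comment> \<open>Absolute values make \<open>a\<close> positive diagonal although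
      \<open>t\<close> may have negative entries; lengths are unaffected.\<close>
    define a where "a = diagm (\<lambda>i. c * (d i * \<bar>t i\<bar>))"
    have "prod (\<lambda>i. c * (d i * \<bar>t i\<bar>)) UNIV = c ^ CARD('n) * (p * \<bar>prod t UNIV\<bar>)"
      by (simp add: prod.distrib p_def abs_prod)
    then have det: "det a = 1" using c p g(3) by (simp add: a_def det_diagm)
    then have a: "a \<in> pos_diag"
      using c d t by (auto simp: pos_diag_def SL_real_def a_def) (auto simp: diagm_def)
    have "balanced (diagm (\<lambda>i. d i * t i) ** (g ** \<gamma>))"
      using d(2) by (simp add: matrix_mul_assoc diagm_mult_diagm)
    then have "balanced (a ** (g ** \<gamma>))"
      unfolding a_def by (rule balanced_diagm[where c=c]) (use c d in \<open>auto simp: abs_mult less_imp_le\<close>)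
    moreover have "det (a ** (g ** \<gamma>)) = 1"
      using det g by (simp add: det_mul SL_real_def SL_int_def)
    ultimately have "well_rounded (coset (a ** g ** \<gamma>))"
      by (intro well_rounded_coset) (simp_all add: matrix_mul_assoc)
    moreover have "coset (a ** g ** \<gamma>) = translate a x"
      unfolding g(1) translate_coset using g(4) by (rule coset_mult_SL_int)
    ultimately show ?thesis using a by (auto simp: diag_orbit_def)
  qed
  with AE_in_saturation[OF assms(2) N] show ?thesis by (rule eventually_mono)
qed

end
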